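(* Let $m$ be an even positive integer and let $r$ be a positive integer with $r<m/2$ and $\gcd(r,m)=1$. For every $b\in\mathbb{F}_{2^m}^*$, the function $f_{b,0,r}:\mathbb{F}_{2^m}\times\mathbb{F}_{2^m}\to\mathbb{F}_{2^m}\times\mathbb{F}_{2^m}$ given by \[ f_{b,0,r}(x,y)=\big(xy,\; x^{2^r+1}+x^{2^{r+m/2}}y^{2^{m/2}}+bxy^{2^r}\big) \] is not APN.
   Context: A function $f:V\to V$, where $V=\mathbb{F}_{2^m}\times\mathbb{F}_{2^m}$ with componentwise addition, is called almost perfect nonlinear (APN) if for every nonzero $a\in V$ and every $\beta\in V$ the equation $f(z+a)+f(z)=\beta$ has at most two solutions $z\in V$. *)

theory Defs
  imports "HOL-Library.Product_Plus" "HOL-Library.Cardinality"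
begin

definition apn :: "('a::{field,finite} \<times> 'a \<Rightarrow> 'a \<times> 'a) \<Rightarrow> bool" where
  "apn f \<longleftrightarrow> (\<forall>a \<beta>. a \<noteq> 0 \<longrightarrow> card {z. f (z + a) + f z = \<beta>} \<le> 2)"

(* f_{b,0,r} on F x F with F the field of order 2^m; the exponent m div 2 is exact since m is even
   wherever the function is used. *)
definition f_b0r :: "nat \<Rightarrow> nat \<Rightarrow> 'a::{field,finite} \<Rightarrow> 'a \<times> 'a \<Rightarrow> 'a \<times> 'a" where
  "f_b0r m r b = (\<lambda>(x, y).
     (x * y,
      x ^ (2 ^ r + 1) + x ^ (2 ^ (r + m div 2)) * y ^ (2 ^ (m div 2)) + b * x * y ^ (2 ^ r)))"

end

theory Submission
  imports Defs
begin

text \<open>Every monomial in both coordinates contains \<open>x\<close> to a positive power, since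
  powers of 2 are never 0.\<close>

lemma f_b0r_zero_left: "f_b0r m r b (0, y) = 0"
  by (simp add: f_b0r_def zero_prod_def power_0_left)

theorem theorem3p3:
  fixes m r :: nat and b :: "'a::{field,finite}"
  assumes "CARD('a) = 2 ^ m"
    and "0 < m" and "even m"
    and "0 < r" and "r < m div 2" and "gcd r m = 1"
    and "b \<noteq> 0"
  shows "\<not> apn (f_b0r m r b)"
proof
  \<comment> \<open>The function vanishes on the line \<open>x = 0\<close>, so all \<open>2 ^ m\<close> points of this line solve
    the equation with \<open>a = (0, 1)\<close> and \<open>\<beta> = 0\<close>.\<close>
  let ?S = "{z. f_b0r m r b (z + (0, 1)) + f_b0r m r b z = 0}"
  assume "apn (f_b0r m r b)"
  then have upper: "card ?S \<le> 2"
    by (simp add: apn_def zero_prod_def)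
  \<comment> \<open>Translation by \<open>(0, 1)\<close> maps the line to itself, so both summands
    vanish there.\<close>
  have "Pair 0 ` UNIV \<subseteq> ?S"
    by (auto simp: f_b0r_zero_left)
  then have "card (Pair (0::'a) ` (UNIV :: 'a set)) \<le> card ?S"
    by (intro card_mono) auto
  then have "2 ^ m \<le> card ?S"
    using assms(1) by (simp add: card_image inj_on_def)
  \<comment> \<open>From \<open>0 < r\<close> and \<open>r < m div 2\<close> one gets
    \<open>m \<ge> 4\<close>; already \<open>m \<ge> 2\<close> yields at least 4 solutions, against
    the bound 2.\<close>
  moreover have "(2::nat) ^ 2 \<le> 2 ^ m"
    using assms(4,5) by (intro power_increasing) auto
  ultimately show False
    using upper by simp
qed

end
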